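(* Let $\mathcal H,\mathcal H',\check{\mathcal H},\widetilde{\mathcal H},\widetilde{\mathcal H}'$ be complex Banach spaces, let $D:\Omega_D\to\mathcal L(\check{\mathcal H})$ ($\Omega_D\subset\mathbb C$) be an operator function with domain $\mathcal D(D(\lambda))$, and let $\Omega'\subset\Omega_D\cap\rho(D)$ be non-empty, where $\rho(D)$ is the set of $\lambda$ with $0\in\rho(D(\lambda))$. Let $A:\Omega'\to\mathcal L(\mathcal H,\mathcal H')$, $B:\Omega'\to\mathcal L(\check{\mathcal H},\mathcal H')$, $C:\Omega'\to\mathcal L(\mathcal H,\check{\mathcal H})$ be operator functions such that for all $\lambda\in\Omega'$: $\mathcal D(D(\lambda))\subset\mathcal D(B(\lambda))$, $C(\lambda)$ is densely defined in $\mathcal H$, and $D(\lambda)^{-1}C(\lambda)$ is bounded on $\mathcal D(C(\lambda))$. Define $$S(\lambda):=A(\lambda)-B(\lambda)D(\lambda)^{-1}C(\lambda),\qquad \mathcal D(S(\lambda)):=\mathcal D(A(\lambda))\cap\mathcal D(C(\lambda)),\qquad\lambda\in\Omega'.$$ Let $\Omega\subset\Omega'$, let $X:\Omega\to\mathcal L(\widetilde{\mathcal H},\mathcal H')$, $Y:\Omega\to\mathcal L(\mathcal H,\widetilde{\mathcal H}')$, $Z:\Omega\to\mathcal L(\widetilde{\mathcal H},\widetilde{\mathcal H}')$ be operator functions, and define, on their natural domains, for $\lambda\in\Omega$, $$\mathcal S(\lambda):=\begin{bmatrix} S(\lambda) & X(\lambda) \\ Y(\lambda) & Z(\lambda) \end{bmatrix}\in\mathcal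 L(\mathcal H\oplus\widetilde{\mathcal H},\mathcal H'\oplus\widetilde{\mathcal H}'),$$ $$\mathcal T(\lambda):=\begin{bmatrix} A(\lambda) & B(\lambda) & X(\lambda) \\ C(\lambda) & D(\lambda) & 0 \\ Y(\lambda) & 0 & Z(\lambda) \end{bmatrix}\in\mathcal L(\mathcal H\oplus\check{\mathcal H}\oplus\widetilde{\mathcal H},\ \mathcal H'\oplus\check{\mathcal H}\oplus\widetilde{\mathcal H}').$$ Then $\mathcal S$ is after $D$-extension equivalent to $\mathcal T$ on $\Omega$, where the extension of $\mathcal S$ by $D$ is taken in the form $$\mathcal S_{\rm ext}(\lambda):=\begin{bmatrix} S(\lambda) & 0 & X(\lambda) \\ 0 & D(\lambda) & 0 \\ Y(\lambda) & 0 & Z(\lambda) \end{bmatrix};$$ that is, for all $\lambda\in\Omega$, $\mathcal S_{\rm ext}(\lambda)=\mathcal E(\lambda)\mathcal T(\lambda)\mathcal F(\lambda)$ and $\mathcal D(\mathcal S_{\rm ext}(\lambda))=\mathcal F(\lambda)^{-1}\mathcal D(\mathcal T(\lambda))$, where the operator matrix functions $\mathcal E,\mathcal F$ in the equivalence relation are $$\mathcal E(\lambda)=\begin{bmatrix} I_{\mathcal H'} & -B(\lambda)D(\lambda)^{-1} & 0 \\ 0 & I_{\check{\mathcal H}} & 0 \\ 0 & 0 & I_{\widetilde{\mathcal H}'} \end{bmatrix},\qquad \mathcal F(\lambda)=\begin{bmatrix} I_{\mathcal H} & 0 & 0 \\ -\overline{D(\lambda)^{-1}C(\lambda)} & I_{\check{\mathcal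 H}} & 0 \\ 0 & 0 & I_{\widetilde{\mathcal H}} \end{bmatrix}.$$
   Context: $\mathcal L(\mathcal X,\mathcal Y)$ denotes the linear, not necessarily bounded, operators $A$ from a domain $\mathcal D(A)\subset\mathcal X$ to $\mathcal Y$; $\mathcal B(\mathcal X,\mathcal Y)$ denotes the everywhere defined bounded ones; $\mathcal L(\mathcal X)=\mathcal L(\mathcal X,\mathcal X)$. $\rho(A)$ is the resolvent set of an operator $A$, and $\overline A$ is the closure of a closable operator $A$. The natural domain of an operator matrix is the direct sum, over the columns, of the intersection of the domains of the entries in that column (zero entries are everywhere defined). Equivalence: operator functions $S:\Omega_S\to\mathcal L(\mathcal H,\mathcal H')$ and $T:\Omega_T\to\mathcal L(\widehat{\mathcal H},\widehat{\mathcal H}')$ are equivalent on $\Omega\subset\Omega_S\cap\Omega_T$ if there are $E:\Omega\to\mathcal B(\widehat{\mathcal H}',\mathcal H')$ and $F:\Omega\to\mathcal B(\mathcal H,\widehat{\mathcal H})$, invertible for each $\lambda\in\Omega$, with $S(\lambda)=E(\lambda)T(\lambda)F(\lambda)$ and $\mathcal D(S(\lambda))=F(\lambda)^{-1}\mathcal D(T(\lambda))$. $S$ is after $W$-extension equivalent to $T$ on $\Omega$ if $W(\lambda)$ is invertible for $\lambda\in\Omega$ and $S\oplus W$ (with domain $\mathcal D(S(\lambda))\oplus\mathcal D(W(\lambda))$) is equivalent to $T$ on $\Omega$. For a $2\times2$ operator matrix function $\mathcal S$ the summand $W$ is inserted as the middle row and column, as displayed in the claim for $W=D$, which agrees with $\mathcal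 S\oplus W$ up to a permutation of the spaces.
   Formalization: The equivalence (with E(λ) bounded) is asserted only if B(λ)D(λ)^{-1} is bounded for all λ in Ω; otherwise it can fail (D=I, B an unbounded functional, other entries 0). The factorisation and domain identity are unconditional. *)

theory Defs
  imports "HOL-Analysis.Analysis"
begin

(* The distribution has only real normed spaces as type classes; a complex Banach space is a
   Banach space whose real scalar multiplication is the restriction of a complex one. *)
class complex_banach = banach +
  fixes scaleC :: "complex \<Rightarrow> 'a \<Rightarrow> 'a"  (infixr "*\<^sub>C" 75)
  assumes scaleC_add_right: "z *\<^sub>C (x + y) = z *\<^sub>C x + z *\<^sub>C y"
    and scaleC_add_left: "(z + w) *\<^sub>C x = z *\<^sub>C x + w *\<^sub>C x"
    and scaleC_scaleC: "z *\<^sub>C w *\<^sub>C x = (z * w) *\<^sub>C x"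
    and scaleC_of_real: "complex_of_real r *\<^sub>C x = r *\<^sub>R x"
    and norm_scaleC: "norm (z *\<^sub>C x) = cmod z * norm x"

instantiation complex :: complex_banach
begin
definition scaleC_complex :: "complex \<Rightarrow> complex \<Rightarrow> complex"
  where "scaleC_complex z x = z * x"
instance
  by standard (auto simp: scaleC_complex_def algebra_simps norm_mult scaleR_conv_of_real)
end

(* The product carries the Hilbert-sum norm of Product_Vector, equivalent to any other
   usual norm on the direct sum. *)
instantiation prod :: (complex_banach, complex_banach) complex_banach
begin
definition scaleC_prod :: "complex \<Rightarrow> 'a \<times> 'b \<Rightarrow> 'a \<times> 'b"
  where "scaleC_prod z p = (z *\<^sub>C fst p, z *\<^sub>C snd p)"
instance
proof
  fix z w :: complex and x y :: "'a \<times> 'b" and r :: real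
  show "norm (z *\<^sub>C x) = cmod z * norm x"
  proof -
    have "(cmod z * norm (fst x))\<^sup>2 + (cmod z * norm (snd x))\<^sup>2
        = (cmod z)\<^sup>2 * ((norm (fst x))\<^sup>2 + (norm (snd x))\<^sup>2)"
      by (simp add: algebra_simps)
    then show ?thesis
      by (simp add: scaleC_prod_def norm_prod_def norm_scaleC real_sqrt_mult)
  qed
qed (auto simp: scaleC_prod_def prod_eq_iff scaleC_add_right scaleC_add_left
       scaleC_scaleC scaleC_of_real)
end

lemma scaleC_Pair [simp]: "z *\<^sub>C (x, y) = (z *\<^sub>C x, z *\<^sub>C y)"
  by (simp add: scaleC_prod_def)

lemma scaleC_zero_right [simp]: "z *\<^sub>C (0 :: 'a::complex_banach) = 0"
  using scaleC_add_right[of z "0::'a" 0] by simp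

lemma scaleC_minus_right: "z *\<^sub>C (- x) = - (z *\<^sub>C (x :: 'a::complex_banach))"
  using scaleC_add_right[of z x "- x"] by (simp add: eq_neg_iff_add_eq_0 add.commute)

lemma scaleC_diff_right: "z *\<^sub>C (x - y) = z *\<^sub>C x - z *\<^sub>C (y :: 'a::complex_banach)"
  using scaleC_add_right[of z x "- y"] by (simp add: scaleC_minus_right)

lemma bounded_linear_scaleC: "bounded_linear (\<lambda>x :: 'a::complex_banach. z *\<^sub>C x)"
proof (rule bounded_linear_intro[where K = "cmod z"])
  fix r and x :: 'a
  show "z *\<^sub>C r *\<^sub>R x = r *\<^sub>R z *\<^sub>C x"
    by (simp flip: scaleC_of_real add: scaleC_scaleC mult.commute)
qed (auto simp: scaleC_add_right norm_scaleC mult.commute)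

definition csubspace :: "'a::complex_banach set \<Rightarrow> bool" where
  "csubspace V \<longleftrightarrow> 0 \<in> V \<and> (\<forall>x\<in>V. \<forall>y\<in>V. x + y \<in> V) \<and> (\<forall>z. \<forall>x\<in>V. z *\<^sub>C x \<in> V)"

lemma csubspace_closure:
  assumes "csubspace V" shows "csubspace (closure V)"
  unfolding csubspace_def
proof (intro conjI ballI allI)
  show "0 \<in> closure V"
    using assms closure_subset by (auto simp: csubspace_def)
next
  fix x y assume "x \<in> closure V" "y \<in> closure V"
  then obtain f g where "\<forall>n. f n \<in> V" "f \<longlonglongrightarrow> x" "\<forall>n. g n \<in> V" "g \<longlonglongrightarrow> y"
    unfolding closure_sequential by blast
  then have "\<forall>n. f n + g n \<in> V" "(\<lambda>n. f n + g n) \<longlonglongrightarrow> x + y"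
    using assms by (auto simp: csubspace_def intro: tendsto_add)
  then show "x + y \<in> closure V"
    unfolding closure_sequential by (intro exI[of _ "\<lambda>n. f n + g n"] conjI)
next
  fix z x assume "x \<in> closure V"
  then obtain f where "\<forall>n. f n \<in> V" "f \<longlonglongrightarrow> x"
    unfolding closure_sequential by blast
  then have "\<forall>n. z *\<^sub>C f n \<in> V" "(\<lambda>n. z *\<^sub>C f n) \<longlonglongrightarrow> z *\<^sub>C x"
    using assms bounded_linear.tendsto[OF bounded_linear_scaleC] by (auto simp: csubspace_def)
  then show "z *\<^sub>C x \<in> closure V"
    unfolding closure_sequential by (intro exI[of _ "\<lambda>n. z *\<^sub>C f n"] conjI)
qed

(* A linear, not necessarily bounded, operator from a domain in 'a to 'b is identified with its
   graph, so that equality of operators includes equality of their domains. *)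
typedef (overloaded) ('a::complex_banach, 'b::complex_banach) lin_op =
  "{G :: ('a \<times> 'b) set. csubspace G \<and> (\<forall>y. (0, y) \<in> G \<longrightarrow> y = 0)}"
  morphisms graph Abs_lin_op
  by (rule exI[of _ "{0}"]) (auto simp: csubspace_def zero_prod_def)

definition op_dom :: "('a::complex_banach, 'b::complex_banach) lin_op \<Rightarrow> 'a set" where
  "op_dom A = {x. \<exists>y. (x, y) \<in> graph A}"

(* meaningful only for x in the domain of A *)
definition op_app :: "('a::complex_banach, 'b::complex_banach) lin_op \<Rightarrow> 'a \<Rightarrow> 'b" where
  "op_app A x = (THE y. (x, y) \<in> graph A)"

lemma graph_zero: "(0, 0) \<in> graph A"
  and graph_add: "(x, y) \<in> graph A \<Longrightarrow> (x', y') \<in> graph A \<Longrightarrow> (x + x', y + y') \<in> graph A"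
  and graph_scaleC: "(x, y) \<in> graph A \<Longrightarrow> (z *\<^sub>C x, z *\<^sub>C y) \<in> graph A"
  and graph_zeroD: "(0, y) \<in> graph A \<Longrightarrow> y = 0"
  using graph[of A] by (force simp: csubspace_def zero_prod_def)+

lemma graph_unique:
  assumes "(x, y) \<in> graph A" "(x, y') \<in> graph A" shows "y = y'"
proof -
  have "((-1) *\<^sub>C x, (-1) *\<^sub>C y') \<in> graph A"
    using assms(2) by (rule graph_scaleC)
  moreover have "(-1) *\<^sub>C v = - v" for v :: "'c::complex_banach"
    using scaleC_of_real[of "-1" v] by simp
  ultimately have "(x + - x, y + - y') \<in> graph A"
    using graph_add[OF assms(1)] by metis
  then show ?thesis
    using graph_zeroD[of "y - y'" A] by simp
qed

lemma graph_iff: "(x, y) \<in> graph A \<longleftrightarrow> x \<in> op_dom A \<and> y = op_app A x"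
proof -
  have "op_app A x = y" if "(x, y) \<in> graph A" for y
    unfolding op_app_def using that graph_unique by blast
  then show ?thesis
    by (auto simp: op_dom_def)
qed

lemma op_dom_zero [simp]: "0 \<in> op_dom A"
  using graph_zero[of A] by (simp add: graph_iff)

lemma op_dom_add [simp]: "x \<in> op_dom A \<Longrightarrow> y \<in> op_dom A \<Longrightarrow> x + y \<in> op_dom A"
  and op_app_add [simp]:
    "x \<in> op_dom A \<Longrightarrow> y \<in> op_dom A \<Longrightarrow> op_app A (x + y) = op_app A x + op_app A y"
  using graph_add[of x "op_app A x" A y "op_app A y"] by (simp_all add: graph_iff)

lemma op_dom_scaleC [simp]: "x \<in> op_dom A \<Longrightarrow> z *\<^sub>C x \<in> op_dom A"
  and op_app_scaleC [simp]: "x \<in> op_dom A \<Longrightarrow> op_app A (z *\<^sub>C x) = z *\<^sub>C op_app A x"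
  using graph_scaleC[of x "op_app A x" A z] by (simp_all add: graph_iff)

lemma op_app_zero [simp]: "op_app A 0 = 0"
  using graph_zero[of A] by (simp add: graph_iff)

lemma lin_op_eqI:
  assumes "op_dom A = op_dom B" "\<And>x. x \<in> op_dom A \<Longrightarrow> op_app A x = op_app B x"
  shows "A = B"
proof -
  have "p \<in> graph A \<longleftrightarrow> p \<in> graph B" for p
    using assms by (cases p) (auto simp: graph_iff)
  then show ?thesis
    using graph_inject by blast
qed

definition linear_on_dom :: "'a::complex_banach set \<Rightarrow> ('a \<Rightarrow> 'b::complex_banach) \<Rightarrow> bool" where
  "linear_on_dom V f \<longleftrightarrow> csubspace V \<and> (\<forall>x\<in>V. \<forall>y\<in>V. f (x + y) = f x + f y)
     \<and> (\<forall>z. \<forall>x\<in>V. f (z *\<^sub>C x) = z *\<^sub>C f x)"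

(* The operator with domain V acting as f; only used when linear_on_dom V f holds. *)
definition lin_op_on :: "'a set \<Rightarrow> ('a \<Rightarrow> 'b) \<Rightarrow> ('a::complex_banach, 'b::complex_banach) lin_op" where
  "lin_op_on V f = Abs_lin_op {(x, f x) |x. x \<in> V}"

lemma
  assumes "linear_on_dom V f"
  shows op_dom_lin_op_on: "op_dom (lin_op_on V f) = V"
    and op_app_lin_op_on: "x \<in> V \<Longrightarrow> op_app (lin_op_on V f) x = f x"
proof -
  have f0: "f 0 = 0"
    using assms by (simp add: linear_on_dom_def csubspace_def) (metis add_cancel_left_left)
  have "csubspace {(x, f x) |x. x \<in> V}"
    using assms f0 by (auto simp: linear_on_dom_def csubspace_def zero_prod_def)
  then have G: "graph (lin_op_on V f) = {(x, f x) |x. x \<in> V}"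
    unfolding lin_op_on_def using f0 by (intro Abs_lin_op_inverse) auto
  show dom: "op_dom (lin_op_on V f) = V"
    by (auto simp: op_dom_def G)
  show "op_app (lin_op_on V f) x = f x" if "x \<in> V"
    using that graph_iff[of x "f x" "lin_op_on V f"] by (simp add: G)
qed

instantiation lin_op :: (complex_banach, complex_banach) "{zero, uminus, minus}"
begin
definition zero_lin_op :: "('a, 'b) lin_op" where
  "0 = lin_op_on UNIV (\<lambda>x. 0)"
definition uminus_lin_op :: "('a, 'b) lin_op \<Rightarrow> ('a, 'b) lin_op" where
  "- A = lin_op_on (op_dom A) (\<lambda>x. - op_app A x)"
definition minus_lin_op :: "('a, 'b) lin_op \<Rightarrow> ('a, 'b) lin_op \<Rightarrow> ('a, 'b) lin_op" where
  "A - B = lin_op_on (op_dom A \<inter> op_dom B) (\<lambda>x. op_app A x - op_app B x)"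
instance ..
end

definition scalar_op :: "complex \<Rightarrow> ('a::complex_banach, 'a) lin_op" where
  "scalar_op z = lin_op_on UNIV (\<lambda>x. z *\<^sub>C x)"

abbreviation id_op :: "('a::complex_banach, 'a) lin_op" where
  "id_op \<equiv> scalar_op 1"

definition op_comp :: "('b::complex_banach, 'c::complex_banach) lin_op \<Rightarrow>
    ('a::complex_banach, 'b) lin_op \<Rightarrow> ('a, 'c) lin_op"  (infixl "\<odot>" 70) where
  "A \<odot> B = lin_op_on {x \<in> op_dom B. op_app B x \<in> op_dom A} (\<lambda>x. op_app A (op_app B x))"

lemma op_dom_0 [simp]: "op_dom 0 = UNIV"
  and op_app_0 [simp]: "op_app 0 x = 0"
  unfolding zero_lin_op_def
  by (subst op_dom_lin_op_on op_app_lin_op_on; simp add: linear_on_dom_def csubspace_def)+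

lemma op_dom_uminus [simp]: "op_dom (- A) = op_dom A"
  and op_app_uminus [simp]: "x \<in> op_dom A \<Longrightarrow> op_app (- A) x = - op_app A x"
  unfolding uminus_lin_op_def
  by (subst op_dom_lin_op_on op_app_lin_op_on;
      simp add: linear_on_dom_def csubspace_def scaleC_minus_right)+

lemma op_dom_minus [simp]: "op_dom (A - B) = op_dom A \<inter> op_dom B"
  and op_app_minus [simp]:
    "x \<in> op_dom A \<Longrightarrow> x \<in> op_dom B \<Longrightarrow> op_app (A - B) x = op_app A x - op_app B x"
  unfolding minus_lin_op_def
  by (subst op_dom_lin_op_on op_app_lin_op_on;
      simp add: linear_on_dom_def csubspace_def scaleC_diff_right)+

lemma op_dom_scalar [simp]: "op_dom (scalar_op z) = UNIV"
  and op_app_scalar: "op_app (scalar_op z) x = z *\<^sub>C x"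
  unfolding scalar_op_def
  by (subst op_dom_lin_op_on op_app_lin_op_on;
      simp add: linear_on_dom_def csubspace_def scaleC_add_right scaleC_scaleC mult.commute)+

lemma op_app_id [simp]: "op_app id_op x = x"
  using scaleC_of_real[of 1 x] by (simp add: op_app_scalar)

lemma op_dom_comp [simp]: "op_dom (A \<odot> B) = {x \<in> op_dom B. op_app B x \<in> op_dom A}"
  and op_app_comp [simp]:
    "x \<in> op_dom B \<Longrightarrow> op_app B x \<in> op_dom A \<Longrightarrow> op_app (A \<odot> B) x = op_app A (op_app B x)"
  unfolding op_comp_def
  by (subst op_dom_lin_op_on op_app_lin_op_on; simp add: linear_on_dom_def csubspace_def)+

definition op_inj :: "('a::complex_banach, 'b::complex_banach) lin_op \<Rightarrow> bool" where
  "op_inj A \<longleftrightarrow> inj_on (op_app A) (op_dom A)"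

definition op_range :: "('a::complex_banach, 'b::complex_banach) lin_op \<Rightarrow> 'b set" where
  "op_range A = op_app A ` op_dom A"

(* only used for injective operators *)
definition op_inv :: "('a::complex_banach, 'b::complex_banach) lin_op \<Rightarrow> ('b, 'a) lin_op" where
  "op_inv A = lin_op_on (op_range A) (the_inv_into (op_dom A) (op_app A))"

lemma
  assumes "op_inj A"
  shows op_dom_inv [simp]: "op_dom (op_inv A) = op_range A"
    and op_app_inv: "x \<in> op_dom A \<Longrightarrow> op_app (op_inv A) (op_app A x) = x"
proof -
  let ?g = "the_inv_into (op_dom A) (op_app A)"
  have g: "?g (op_app A x) = x" if "x \<in> op_dom A" for x
    using that assms by (simp add: op_inj_def the_inv_into_f_f)
  have add: "op_app A x + op_app A y = op_app A (x + y)"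
    and scale: "z *\<^sub>C op_app A x = op_app A (z *\<^sub>C x)"
    if "x \<in> op_dom A" "y \<in> op_dom A" for x y z
    using that by simp_all
  have "csubspace (op_range A)"
    unfolding csubspace_def op_range_def
    by (auto simp: add scale simp del: op_app_add op_app_scaleC
        intro!: image_eqI[where x = 0] imageI)
  then have "linear_on_dom (op_range A) ?g"
    unfolding linear_on_dom_def op_range_def
    by (auto simp: add scale g simp del: op_app_add op_app_scaleC)
  then show "op_dom (op_inv A) = op_range A"
    and "x \<in> op_dom A \<Longrightarrow> op_app (op_inv A) (op_app A x) = x"
    unfolding op_inv_def
    by (simp_all add: op_dom_lin_op_on op_app_lin_op_on g op_range_def)
qed

definition closable :: "('a::complex_banach, 'b::complex_banach) lin_op \<Rightarrow> bool" where
  "closable A \<longleftrightarrow> (\<forall>y. (0, y) \<in> closure (graph A) \<longrightarrow> y = 0)"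

(* only used for closable operators *)
definition op_closure :: "('a::complex_banach, 'b::complex_banach) lin_op \<Rightarrow> ('a, 'b) lin_op" where
  "op_closure A = Abs_lin_op (closure (graph A))"

lemma graph_op_closure: "closable A \<Longrightarrow> graph (op_closure A) = closure (graph A)"
  unfolding op_closure_def closable_def
  using graph[of A] by (intro Abs_lin_op_inverse) (auto simp: csubspace_closure)

definition densely_defined :: "('a::complex_banach, 'b::complex_banach) lin_op \<Rightarrow> bool" where
  "densely_defined A \<longleftrightarrow> closure (op_dom A) = UNIV"

(* bounded on its domain, which need not be the whole space *)
definition op_bounded :: "('a::complex_banach, 'b::complex_banach) lin_op \<Rightarrow> bool" where
  "op_bounded A \<longleftrightarrow> (\<exists>K. \<forall>x\<in>op_dom A. norm (op_app A x) \<le> K * norm x)"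

definition bounded_ops :: "('a::complex_banach, 'b::complex_banach) lin_op set" where
  "bounded_ops = {A. op_dom A = UNIV \<and> op_bounded A}"

definition op_invertible :: "('a::complex_banach, 'b::complex_banach) lin_op \<Rightarrow> bool" where
  "op_invertible A \<longleftrightarrow> op_inj A \<and> op_range A = UNIV \<and> op_inv A \<in> bounded_ops"

definition resolvent_set :: "('a::complex_banach, 'a) lin_op \<Rightarrow> complex set" where
  "resolvent_set A = {z. op_invertible (A - scalar_op z)}"

(* Operator matrices, entries listed row by row, on their natural domains. *)
definition block2 ::
    "('a1::complex_banach, 'b1::complex_banach) lin_op \<Rightarrow> ('a2::complex_banach, 'b1) lin_op \<Rightarrow>
     ('a1, 'b2::complex_banach) lin_op \<Rightarrow> ('a2, 'b2) lin_op \<Rightarrow>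
     ('a1 \<times> 'a2, 'b1 \<times> 'b2) lin_op" where
  "block2 M11 M12
          M21 M22 =
   lin_op_on
     ((op_dom M11 \<inter> op_dom M21) \<times> (op_dom M12 \<inter> op_dom M22))
     (\<lambda>(x1, x2). (op_app M11 x1 + op_app M12 x2,
                  op_app M21 x1 + op_app M22 x2))"

definition block3 ::
    "('a1::complex_banach, 'b1::complex_banach) lin_op \<Rightarrow>
     ('a2::complex_banach, 'b1) lin_op \<Rightarrow> ('a3::complex_banach, 'b1) lin_op \<Rightarrow>
     ('a1, 'b2::complex_banach) lin_op \<Rightarrow> ('a2, 'b2) lin_op \<Rightarrow> ('a3, 'b2) lin_op \<Rightarrow>
     ('a1, 'b3::complex_banach) lin_op \<Rightarrow> ('a2, 'b3) lin_op \<Rightarrow> ('a3, 'b3) lin_op \<Rightarrow>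
     ('a1 \<times> 'a2 \<times> 'a3, 'b1 \<times> 'b2 \<times> 'b3) lin_op" where
  "block3 M11 M12 M13
          M21 M22 M23
          M31 M32 M33 =
   lin_op_on
     ((op_dom M11 \<inter> op_dom M21 \<inter> op_dom M31) \<times>
      (op_dom M12 \<inter> op_dom M22 \<inter> op_dom M32) \<times>
      (op_dom M13 \<inter> op_dom M23 \<inter> op_dom M33))
     (\<lambda>(x1, x2, x3). (op_app M11 x1 + op_app M12 x2 + op_app M13 x3,
                      op_app M21 x1 + op_app M22 x2 + op_app M23 x3,
                      op_app M31 x1 + op_app M32 x2 + op_app M33 x3))"

lemma op_dom_block2:
    "op_dom (block2 M11 M12 M21 M22) =
      (op_dom M11 \<inter> op_dom M21) \<times> (op_dom M12 \<inter> op_dom M22)"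
  and op_app_block2:
    "x1 \<in> op_dom M11 \<inter> op_dom M21 \<Longrightarrow> x2 \<in> op_dom M12 \<inter> op_dom M22 \<Longrightarrow>
     op_app (block2 M11 M12 M21 M22) (x1, x2) =
      (op_app M11 x1 + op_app M12 x2, op_app M21 x1 + op_app M22 x2)"
  unfolding block2_def
  by (subst op_dom_lin_op_on op_app_lin_op_on;
      auto simp: linear_on_dom_def csubspace_def zero_prod_def scaleC_add_right)+

lemma op_dom_block3:
    "op_dom (block3 M11 M12 M13 M21 M22 M23 M31 M32 M33) =
      (op_dom M11 \<inter> op_dom M21 \<inter> op_dom M31) \<times>
      (op_dom M12 \<inter> op_dom M22 \<inter> op_dom M32) \<times>
      (op_dom M13 \<inter> op_dom M23 \<inter> op_dom M33)"
  and op_app_block3: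
    "x1 \<in> op_dom M11 \<inter> op_dom M21 \<inter> op_dom M31 \<Longrightarrow>
     x2 \<in> op_dom M12 \<inter> op_dom M22 \<inter> op_dom M32 \<Longrightarrow>
     x3 \<in> op_dom M13 \<inter> op_dom M23 \<inter> op_dom M33 \<Longrightarrow>
     op_app (block3 M11 M12 M13 M21 M22 M23 M31 M32 M33) (x1, x2, x3) =
      (op_app M11 x1 + op_app M12 x2 + op_app M13 x3,
       op_app M21 x1 + op_app M22 x2 + op_app M23 x3,
       op_app M31 x1 + op_app M32 x2 + op_app M33 x3)"
  unfolding block3_def
  by (subst op_dom_lin_op_on op_app_lin_op_on;
      auto simp: linear_on_dom_def csubspace_def zero_prod_def scaleC_add_right)+

(* The direct sum of M and W, with W inserted as the middle row and column. *)
definition middle_sum ::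
    "('a1::complex_banach \<times> 'a2::complex_banach, 'b1::complex_banach \<times> 'b2::complex_banach) lin_op \<Rightarrow>
     ('w::complex_banach, 'v::complex_banach) lin_op \<Rightarrow>
     ('a1 \<times> 'w \<times> 'a2, 'b1 \<times> 'v \<times> 'b2) lin_op" where
  "middle_sum M W =
   lin_op_on {(x1, w, x2). (x1, x2) \<in> op_dom M \<and> w \<in> op_dom W}
     (\<lambda>(x1, w, x2). (fst (op_app M (x1, x2)), op_app W w, snd (op_app M (x1, x2))))"

lemma op_dom_middle_sum:
    "op_dom (middle_sum M W) = {(x1, w, x2). (x1, x2) \<in> op_dom M \<and> w \<in> op_dom W}"
  and op_app_middle_sum:
    "(x1, x2) \<in> op_dom M \<Longrightarrow> w \<in> op_dom W \<Longrightarrow>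
     op_app (middle_sum M W) (x1, w, x2) =
      (fst (op_app M (x1, x2)), op_app W w, snd (op_app M (x1, x2)))"
proof -
  have *: "linear_on_dom {(x1, w, x2). (x1, x2) \<in> op_dom M \<and> w \<in> op_dom W}
     (\<lambda>(x1, w, x2). (fst (op_app M (x1, x2)), op_app W w, snd (op_app M (x1, x2))))"
  proof -
    have "(x + x', y + y') \<in> op_dom M"
      "op_app M (x + x', y + y') = op_app M (x, y) + op_app M (x', y')"
      if "(x, y) \<in> op_dom M" "(x', y') \<in> op_dom M" for x x' y y'
      using op_dom_add[OF that] op_app_add[OF that] by simp_all
    moreover have "(z *\<^sub>C x, z *\<^sub>C y) \<in> op_dom M"
      "op_app M (z *\<^sub>C x, z *\<^sub>C y) = z *\<^sub>C op_app M (x, y)"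
      if "(x, y) \<in> op_dom M" for z x y
      using op_dom_scaleC[OF that] op_app_scaleC[OF that] by simp_all
    moreover have "(0, 0) \<in> op_dom M"
      using op_dom_zero[of M] by (simp add: zero_prod_def)
    ultimately show ?thesis
      by (auto simp: linear_on_dom_def csubspace_def zero_prod_def scaleC_prod_def)
  qed
  show "op_dom (middle_sum M W) = {(x1, w, x2). (x1, x2) \<in> op_dom M \<and> w \<in> op_dom W}"
    unfolding middle_sum_def by (rule op_dom_lin_op_on[OF *])
  show "op_app (middle_sum M W) (x1, w, x2) =
      (fst (op_app M (x1, x2)), op_app W w, snd (op_app M (x1, x2)))"
    if "(x1, x2) \<in> op_dom M" "w \<in> op_dom W"
    unfolding middle_sum_def using that by (subst op_app_lin_op_on[OF *]) auto
qed

lemma middle_sum_block2: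
  "middle_sum (block2 M11 M12 M21 M22) W = block3 M11 0 M12 0 W 0 M21 0 M22"
  by (rule lin_op_eqI)
     (auto simp: op_dom_middle_sum op_app_middle_sum op_dom_block2 op_app_block2
        op_dom_block3 op_app_block3)

(* Operator functions on subsets of the complex plane are total functions whose values outside
   the set in question are irrelevant. The domain condition below is part of the usual
   definition, although the equality of partial operators already implies it. *)
definition equivalent_via ::
    "complex set \<Rightarrow> (complex \<Rightarrow> ('h::complex_banach, 'h1::complex_banach) lin_op) \<Rightarrow>
     (complex \<Rightarrow> ('k::complex_banach, 'k1::complex_banach) lin_op) \<Rightarrow>
     (complex \<Rightarrow> ('k1, 'h1) lin_op) \<Rightarrow> (complex \<Rightarrow> ('h, 'k) lin_op) \<Rightarrow> bool" where
  "equivalent_via \<Omega> S T E F \<longleftrightarrow> (\<forall>z\<in>\<Omega>.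
     E z \<in> bounded_ops \<and> op_invertible (E z) \<and>
     F z \<in> bounded_ops \<and> op_invertible (F z) \<and>
     S z = E z \<odot> T z \<odot> F z \<and>
     op_dom (S z) = op_app (op_inv (F z)) ` op_dom (T z))"

definition equivalent_on ::
    "complex set \<Rightarrow> (complex \<Rightarrow> ('h::complex_banach, 'h1::complex_banach) lin_op) \<Rightarrow>
     (complex \<Rightarrow> ('k::complex_banach, 'k1::complex_banach) lin_op) \<Rightarrow> bool" where
  "equivalent_on \<Omega> S T \<longleftrightarrow> (\<exists>E F. equivalent_via \<Omega> S T E F)"

definition after_extension_equivalent_on ::
    "complex set \<Rightarrow>
     (complex \<Rightarrow> ('a1::complex_banach \<times> 'a2::complex_banach,
                  'b1::complex_banach \<times> 'b2::complex_banach) lin_op) \<Rightarrow>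
     (complex \<Rightarrow> ('w::complex_banach, 'v::complex_banach) lin_op) \<Rightarrow>
     (complex \<Rightarrow> ('k::complex_banach, 'k1::complex_banach) lin_op) \<Rightarrow> bool" where
  "after_extension_equivalent_on \<Omega> S W T \<longleftrightarrow>
     (\<forall>z\<in>\<Omega>. op_invertible (W z)) \<and>
     equivalent_on \<Omega> (\<lambda>z. middle_sum (S z) (W z)) T"

end

(* The factorisation S_ext = E T F is block elimination with pivot D, and E and F are unipotent,
   hence inverted by changing the sign of their off-diagonal entry.  The analytic
   ingredient is that the bounded, densely defined D^{-1} C has an everywhere defined bounded
   closure; on the domain of C this closure takes its values in the domain of D, which is what
   makes F match the domains of S_ext and T. *)
theory Submission
  imports Defs
begin

section \<open>Differences and everywhere defined bounded operators\<close>

lemma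
  assumes "x \<in> op_dom A"
  shows op_dom_scaleR: "r *\<^sub>R x \<in> op_dom A"
    and op_app_scaleR: "op_app A (r *\<^sub>R x) = r *\<^sub>R op_app A x"
  using op_dom_scaleC[OF assms, of "complex_of_real r"]
    op_app_scaleC[OF assms, of "complex_of_real r"] by (simp_all add: scaleC_of_real)

lemma
  assumes "x \<in> op_dom A" "y \<in> op_dom A"
  shows op_dom_diff: "x - y \<in> op_dom A"
    and op_app_diff: "op_app A (x - y) = op_app A x - op_app A y"
  using op_dom_add[OF assms(1) op_dom_scaleR[OF assms(2), of "-1"]]
    op_app_add[OF assms(1) op_dom_scaleR[OF assms(2), of "-1"]] op_app_scaleR[OF assms(2), of "-1"]
  by simp_all

text \<open>Gives access to the library's rules for \<open>bounded_linear\<close>, which concern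
  real scalars only; complex linearity is already part of the type \<open>lin_op\<close>.\<close>

lemma bounded_ops_iff_bounded_linear:
  "A \<in> bounded_ops \<longleftrightarrow> op_dom A = UNIV \<and> bounded_linear (op_app A)"
proof
  assume "A \<in> bounded_ops"
  then obtain K where "op_dom A = UNIV" "\<And>x. norm (op_app A x) \<le> K * norm x"
    by (auto simp: bounded_ops_def op_bounded_def)
  then show "op_dom A = UNIV \<and> bounded_linear (op_app A)"
    by (auto simp: op_app_scaleR mult.commute intro!: bounded_linear_intro[where K = K])
next
  assume "op_dom A = UNIV \<and> bounded_linear (op_app A)"
  then show "A \<in> bounded_ops"
    using bounded_linear.bounded[of "op_app A"]
    by (auto simp: bounded_ops_def op_bounded_def mult.commute)
qed

lemma zero_in_bounded_ops: "0 \<in> bounded_ops"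
  and id_in_bounded_ops: "id_op \<in> bounded_ops"
  and uminus_in_bounded_ops: "A \<in> bounded_ops \<Longrightarrow> - A \<in> bounded_ops"
  by (auto simp: bounded_ops_def op_bounded_def intro: exI[of _ 0] exI[of _ 1])

text \<open>Each component of the matrix is a sum of bounded linear maps composed with coordinate
  projections.\<close>

lemma block3_in_bounded_ops:
  assumes "M11 \<in> bounded_ops" "M12 \<in> bounded_ops" "M13 \<in> bounded_ops"
    "M21 \<in> bounded_ops" "M22 \<in> bounded_ops" "M23 \<in> bounded_ops"
    "M31 \<in> bounded_ops" "M32 \<in> bounded_ops" "M33 \<in> bounded_ops"
  shows "block3 M11 M12 M13 M21 M22 M23 M31 M32 M33 \<in> bounded_ops" (is "?M \<in> _")
proof -
  note M = assms[unfolded bounded_ops_iff_bounded_linear]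
  have dom: "op_dom ?M = UNIV"
    using M by (simp add: op_dom_block3)
  let ?x1 = "\<lambda>p. fst p" and ?x2 = "\<lambda>p. fst (snd p)" and ?x3 = "\<lambda>p. snd (snd p)"
  have "op_app ?M = (\<lambda>p.
      (op_app M11 (?x1 p) + op_app M12 (?x2 p) + op_app M13 (?x3 p),
       op_app M21 (?x1 p) + op_app M22 (?x2 p) + op_app M23 (?x3 p),
       op_app M31 (?x1 p) + op_app M32 (?x2 p) + op_app M33 (?x3 p)))"
    using M by (auto simp: op_app_block3)
  moreover have "bounded_linear \<dots>"
    using M by (intro bounded_linear_Pair bounded_linear_add)
      (auto intro!: bounded_linear_compose[where f = "op_app _"] bounded_linear_fst_comp
        bounded_linear_snd_comp bounded_linear_fst bounded_linear_snd)
  ultimately show ?thesis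
    using dom by (simp add: bounded_ops_iff_bounded_linear)
qed

section \<open>Inverses and composition domains\<close>

text \<open>Purely algebraic: neither operator is assumed bounded, so that the result also covers
  the left factor of the factorisation when its off-diagonal entry is unbounded.\<close>

lemma
  assumes dom: "op_dom A = UNIV" "op_dom B = UNIV"
    and AB: "\<And>y. op_app A (op_app B y) = y" and BA: "\<And>x. op_app B (op_app A x) = x"
  shows op_inj_of_inverse: "op_inj A"
    and op_range_of_inverse: "op_range A = UNIV"
    and op_inv_of_inverse: "op_inv A = B"
proof -
  show inj: "op_inj A"
    unfolding op_inj_def by (metis BA inj_onI)
  show range: "op_range A = UNIV"
    unfolding op_range_def dom by (metis AB surjI)
  have "op_app (op_inv A) y = op_app B y" for y
    using op_app_inv[OF inj, of "op_app B y"] by (simp add: AB dom)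
  then show "op_inv A = B"
    by (intro lin_op_eqI) (simp_all add: inj range dom)
qed

lemma op_invertible_of_inverse:
  assumes "op_dom A = UNIV" "B \<in> bounded_ops"
    and "\<And>y. op_app A (op_app B y) = y" "\<And>x. op_app B (op_app A x) = x"
  shows "op_invertible A"
  using op_inj_of_inverse[of A B] op_range_of_inverse[of A B] op_inv_of_inverse[of A B] assms
  by (simp add: op_invertible_def bounded_ops_def)

lemma op_invertibleD:
  assumes "op_invertible D"
  shows "op_inj D" "op_range D = UNIV" "op_dom (op_inv D) = UNIV"
    and "op_app (op_inv D) y \<in> op_dom D" "op_app D (op_app (op_inv D) y) = y"
proof -
  show inj: "op_inj D" and range: "op_range D = UNIV"
    using assms by (simp_all add: op_invertible_def)
  then show "op_dom (op_inv D) = UNIV"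
    by simp
  obtain x where "x \<in> op_dom D" "y = op_app D x"
    using range unfolding op_range_def by blast
  then show "op_app (op_inv D) y \<in> op_dom D" "op_app D (op_app (op_inv D) y) = y"
    by (simp_all add: op_app_inv[OF inj])
qed

lemma zero_in_resolvent_set_iff: "0 \<in> resolvent_set D \<longleftrightarrow> op_invertible D"
proof -
  have "0 *\<^sub>C x = 0" for x :: "'a"
    using scaleC_of_real[of 0 x] by simp
  then have "D - scalar_op 0 = D"
    by (intro lin_op_eqI) (simp_all add: op_app_scalar)
  then show ?thesis
    by (simp add: resolvent_set_def)
qed

text \<open>An everywhere defined \<open>E\<close> imposes no condition, so the domain is the
  preimage of \<open>op_dom T\<close> under \<open>F\<close>; bijectivity of \<open>F\<close> turns
  the preimage into an image under the inverse. This is the domain condition in the definition of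
  equivalence.\<close>

lemma op_dom_comp_image_inv:
  assumes "op_dom E = UNIV" "op_dom F = UNIV" "op_invertible F"
  shows "op_dom (E \<odot> T \<odot> F) = op_app (op_inv F) ` op_dom T"
proof -
  have "op_app F x \<in> op_dom T \<longleftrightarrow> x \<in> op_app (op_inv F) ` op_dom T" for x
    using op_app_inv[of F x] op_invertibleD[OF assms(3)] assms(2) by (auto intro: rev_image_eqI)
  then show ?thesis
    using assms by auto
qed

section \<open>The closure of a bounded, densely defined operator\<close>

text \<open>Bounded linear extension in terms of graphs: the norm bound is a closed condition and
  passes to the closure of the graph, while density and completeness of the target space make the
  domain of the closure everything.\<close>

lemma
  assumes bdd: "op_bounded G" and dense: "densely_defined G"
  shows op_closure_in_bounded_ops: "op_closure G \<in> bounded_ops"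
    and op_app_op_closure: "x \<in> op_dom G \<Longrightarrow> op_app (op_closure G) x = op_app G x"
proof -
  obtain K where K: "\<And>x. x \<in> op_dom G \<Longrightarrow> norm (op_app G x) \<le> K * norm x"
    using bdd by (auto simp: op_bounded_def)
  have "closed {p :: 'a \<times> 'b. norm (snd p) \<le> K * norm (fst p)}"
    by (intro closed_Collect_le continuous_intros)
  then have "closure (graph G) \<subseteq> {p. norm (snd p) \<le> K * norm (fst p)}"
    by (intro closure_minimal) (auto simp: graph_iff K)
  then have bound: "norm y \<le> K * norm x" if "(x, y) \<in> closure (graph G)" for x y
    using that by auto
  \<comment> \<open>At \<open>x = 0\<close> the bound forces \<open>y = 0\<close>.\<close>
  have "closable G"
    unfolding closable_def using bound by fastforce
  note gr = graph_op_closure[OF this]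
  have "x \<in> op_dom (op_closure G)" for x
  proof -
    obtain f where f: "\<And>n. f n \<in> op_dom G" "f \<longlonglongrightarrow> x"
      using dense closure_sequential[of x "op_dom G"] unfolding densely_defined_def by blast
    have "Cauchy (\<lambda>n. op_app G (f n))"
    proof (rule metric_CauchyI)
      fix e :: real assume "e > 0"
      \<comment> \<open>\<open>K\<close> may be zero or negative, so the divisor is made
        positive.\<close>
      then have "e / (\<bar>K\<bar> + 1) > 0" by simp
      then obtain N where N: "\<And>m n. m \<ge> N \<Longrightarrow> n \<ge> N \<Longrightarrow> dist (f m) (f n) < e / (\<bar>K\<bar> + 1)"
        using LIMSEQ_imp_Cauchy[OF f(2)] unfolding Cauchy_def by metis
      have "dist (op_app G (f m)) (op_app G (f n)) < e" if "m \<ge> N" "n \<ge> N" for m n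
      proof -
        have "dist (op_app G (f m)) (op_app G (f n)) \<le> K * dist (f m) (f n)"
          using K[OF op_dom_diff[OF f(1) f(1), of m n]]
          by (simp add: dist_norm op_app_diff f(1))
        also have "\<dots> \<le> (\<bar>K\<bar> + 1) * dist (f m) (f n)"
          by (intro mult_right_mono) auto
        also have "\<dots> < e"
          using N[OF that] by (simp add: field_simps)
        finally show ?thesis .
      qed
      then show "\<exists>N. \<forall>m\<ge>N. \<forall>n\<ge>N. dist (op_app G (f m)) (op_app G (f n)) < e"
        by blast
    qed
    \<comment> \<open>Completeness of the target space enters here.\<close>
    then obtain y where "(\<lambda>n. op_app G (f n)) \<longlonglongrightarrow> y"
      using Cauchy_convergent_iff convergent_def by blast
    with f(2) have "(\<lambda>n. (f n, op_app G (f n))) \<longlonglongrightarrow> (x, y)"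
      by (rule tendsto_Pair)
    moreover have "(f n, op_app G (f n)) \<in> graph G" for n
      using f(1) by (simp add: graph_iff)
    ultimately have "(x, y) \<in> closure (graph G)"
      unfolding closure_sequential by (intro exI[of _ "\<lambda>n. (f n, op_app G (f n))"]) simp
    then show ?thesis
      by (simp add: gr[symmetric] graph_iff)
  qed
  then have dom: "op_dom (op_closure G) = UNIV"
    by blast
  then have "(x, op_app (op_closure G) x) \<in> closure (graph G)" for x
    by (simp add: gr[symmetric] graph_iff)
  then show "op_closure G \<in> bounded_ops"
    using bound dom by (auto simp: bounded_ops_def op_bounded_def)
  show "op_app (op_closure G) x = op_app G x" if "x \<in> op_dom G"
  proof -
    have "(x, op_app G x) \<in> graph (op_closure G)"
      using that closure_subset[of "graph G"] by (auto simp: gr graph_iff)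
    then show ?thesis
      by (simp add: graph_iff)
  qed
qed

section \<open>Unipotent block matrices\<close>

text \<open>Elementary matrix: multiplication by it from the left adds \<open>P\<close> times the
  second row to the first.\<close>

abbreviation (input) upper_unipotent ::
    "('b::complex_banach, 'a::complex_banach) lin_op \<Rightarrow>
     ('a \<times> 'b \<times> 'c::complex_banach, 'a \<times> 'b \<times> 'c) lin_op" where
  "upper_unipotent P \<equiv> block3 id_op P 0
                              0 id_op 0
                              0 0 id_op"

text \<open>Elementary matrix: multiplication by it from the right adds the second column times
  \<open>Q\<close> to the first.\<close>

abbreviation (input) lower_unipotent ::
    "('a::complex_banach, 'b::complex_banach) lin_op \<Rightarrow>
     ('a \<times> 'b \<times> 'c::complex_banach, 'a \<times> 'b \<times> 'c) lin_op" where
  "lower_unipotent Q \<equiv> block3 id_op 0 0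
                              Q id_op 0
                              0 0 id_op"

lemma upper_unipotent_total:
  assumes "op_dom P = UNIV"
  shows "op_dom (upper_unipotent P) = UNIV"
    and "op_app (upper_unipotent P) (x, y, w) = (x + op_app P y, y, w)"
  using assms by (simp_all add: op_dom_block3 op_app_block3)

lemma lower_unipotent_total:
  assumes "op_dom Q = UNIV"
  shows "op_dom (lower_unipotent Q) = UNIV"
    and "op_app (lower_unipotent Q) (x, y, w) = (x, op_app Q x + y, w)"
  using assms by (simp_all add: op_dom_block3 op_app_block3)

text \<open>The second coordinate is left fixed, so the shifts of the first coordinate by
  \<open>P\<close> and \<open>- P\<close> cancel.\<close>

lemma upper_unipotent_inverse:
  assumes "op_dom P = UNIV"
  shows "op_app (upper_unipotent P) (op_app (upper_unipotent (- P)) p) = p"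
    and "op_app (upper_unipotent (- P)) (op_app (upper_unipotent P) p) = p"
  using assms by (cases p; simp add: upper_unipotent_total)+

lemma
  assumes P: "op_dom P = UNIV"
  shows op_inj_upper_unipotent: "op_inj (upper_unipotent P)"
    and op_range_upper_unipotent: "op_range (upper_unipotent P) = UNIV"
proof -
  have "op_dom (upper_unipotent P) = UNIV" "op_dom (upper_unipotent (- P)) = UNIV"
    using P by (simp_all add: upper_unipotent_total)
  note inverse = this upper_unipotent_inverse[OF P]
  show "op_inj (upper_unipotent P)"
    using inverse by (rule op_inj_of_inverse)
  show "op_range (upper_unipotent P) = UNIV"
    using inverse by (rule op_range_of_inverse)
qed

lemma unipotent_bounded_ops:
  "P \<in> bounded_ops \<Longrightarrow> upper_unipotent P \<in> bounded_ops"
  "Q \<in> bounded_ops \<Longrightarrow> lower_unipotent Q \<in> bounded_ops"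
  by (simp_all add: block3_in_bounded_ops zero_in_bounded_ops id_in_bounded_ops)

lemma op_invertible_upper_unipotent:
  assumes "P \<in> bounded_ops" shows "op_invertible (upper_unipotent P)"
proof (rule op_invertible_of_inverse)
  have "op_dom P = UNIV"
    using assms by (simp add: bounded_ops_def)
  then show "op_dom (upper_unipotent P) = UNIV"
    and "op_app (upper_unipotent P) (op_app (upper_unipotent (- P)) p) = p"
    and "op_app (upper_unipotent (- P)) (op_app (upper_unipotent P) p) = p" for p
    by (simp_all add: upper_unipotent_total upper_unipotent_inverse)
qed (simp add: assms unipotent_bounded_ops uminus_in_bounded_ops)

lemma op_invertible_lower_unipotent:
  assumes "Q \<in> bounded_ops" shows "op_invertible (lower_unipotent Q)"
proof (rule op_invertible_of_inverse)
  have "op_dom Q = UNIV"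
    using assms by (simp add: bounded_ops_def)
  then show "op_dom (lower_unipotent Q) = UNIV"
    and "op_app (lower_unipotent Q) (op_app (lower_unipotent (- Q)) p) = p"
    and "op_app (lower_unipotent (- Q)) (op_app (lower_unipotent Q) p) = p" for p
    by (cases p; simp add: lower_unipotent_total)+
qed (simp add: assms unipotent_bounded_ops uminus_in_bounded_ops)

section \<open>Block elimination with pivot \<open>D\<close>\<close>

text \<open>On \<open>op_dom C\<close> the operator \<open>Q\<close> is \<open>D\<close> inverse
  times \<open>C\<close>, so \<open>D Q = C\<close> there. Replacing \<open>b\<close> by
  \<open>b - Q a\<close> therefore removes \<open>C\<close> from the second row and turns
  \<open>A\<close> into \<open>S\<close>; the left factor then removes \<open>B\<close> from the
  first row.\<close>

lemma schur_factorisation: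
  assumes D: "op_invertible D" and BD: "op_dom D \<subseteq> op_dom B"
    and Q: "op_dom Q = UNIV"
    and Q_eq: "\<And>x. x \<in> op_dom C \<Longrightarrow> op_app Q x = op_app (op_inv D) (op_app C x)"
    and dom_S: "op_dom S = op_dom A \<inter> op_dom C"
    and S_eq: "\<And>x. x \<in> op_dom A \<inter> op_dom C \<Longrightarrow>
      op_app S x = op_app A x - op_app B (op_app (op_inv D) (op_app C x))"
  shows "block3 S 0 X
                0 D 0
                Y 0 Z =
    upper_unipotent (- (B \<odot> op_inv D)) \<odot>
    block3 A B X
           C D 0
           Y 0 Z \<odot>
    lower_unipotent (- Q)" (is "?S = ?E \<odot> ?T \<odot> ?F")
proof -
  note Dinv = op_invertibleD[OF D]
  \<comment> \<open>The inverse of \<open>D\<close> takes its values in \<open>op_dom D\<close>,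
    which lies in \<open>op_dom B\<close>.\<close>
  have R: "op_dom (B \<odot> op_inv D) = UNIV"
    using BD Dinv by auto
  have RD: "op_app (B \<odot> op_inv D) (op_app D x) = op_app B x" if "x \<in> op_dom D" for x
    using that BD Dinv op_app_inv[OF Dinv(1) that] by auto
  have E: "op_dom ?E = UNIV" "op_app ?E (x, y, w) = (x - op_app (B \<odot> op_inv D) y, y, w)"
    and F: "op_dom ?F = UNIV" "op_app ?F (a, b, c) = (a, b - op_app Q a, c)" for x y w a b c
    using R Q by (simp_all add: upper_unipotent_total lower_unipotent_total del: op_dom_comp)
  have Q_dom: "op_app Q a \<in> op_dom D" and DQ: "op_app D (op_app Q a) = op_app C a"
    and S_Q: "a \<in> op_dom A \<Longrightarrow> op_app S a = op_app A a - op_app B (op_app Q a)"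
    if "a \<in> op_dom C" for a
    using that by (simp_all add: Q_eq Dinv S_eq)
  \<comment> \<open>\<open>op_dom D\<close> is a subspace containing \<open>Q a\<close>, so shifting
    by \<open>Q a\<close> neither enters nor leaves it. Hence the right factor matches the two
    domains.\<close>
  have D_shift: "b - op_app Q a \<in> op_dom D \<longleftrightarrow> b \<in> op_dom D" if "a \<in> op_dom C" for a b
    using op_dom_diff[OF _ Q_dom[OF that], of b] op_dom_add[OF _ Q_dom[OF that], of "b - op_app Q a"]
    by auto
  have B_shift: "b - op_app Q a \<in> op_dom B" if "a \<in> op_dom C" "b \<in> op_dom D" for a b
    using BD D_shift that by blast
  have dom: "op_dom (?E \<odot> ?T \<odot> ?F) =
      {(a, b, c). a \<in> op_dom A \<inter> op_dom C \<inter> op_dom Y \<and> b \<in> op_dom D \<and> c \<in> op_dom X \<inter> op_dom Z}"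
    using B_shift by (auto simp only: op_dom_comp E F) (auto simp: op_dom_block3 D_shift Q)
  show ?thesis
  proof (rule lin_op_eqI)
    show "op_dom ?S = op_dom (?E \<odot> ?T \<odot> ?F)"
      unfolding dom by (auto simp: op_dom_block3 dom_S)
    fix p assume "p \<in> op_dom ?S"
    then obtain a b c where p: "p = (a, b, c)"
      and a: "a \<in> op_dom A" "a \<in> op_dom C" "a \<in> op_dom Y" and b: "b \<in> op_dom D"
      and c: "c \<in> op_dom X" "c \<in> op_dom Z"
      by (auto simp: op_dom_block3 dom_S)
    let ?b = "b - op_app Q a"
    have D_b: "?b \<in> op_dom D" "op_app D ?b = op_app D b - op_app C a"
      using b by (simp_all add: D_shift a op_app_diff Q_dom DQ)
    have B_b: "op_app B ?b = op_app B b - op_app B (op_app Q a)"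
      using BD b Q_dom[OF a(2)] by (intro op_app_diff) auto
    \<comment> \<open>In the second row \<open>C a\<close> cancels against \<open>D (Q a)\<close>,
      leaving \<open>D b\<close>.\<close>
    have T_p: "op_app ?F p \<in> op_dom ?T"
      "op_app ?T (op_app ?F p) =
        (op_app A a + op_app B ?b + op_app X c, op_app D b, op_app Y a + op_app Z c)"
      using a c b D_b B_shift by (simp_all add: p F op_dom_block3 op_app_block3)
    have "op_app (?E \<odot> ?T \<odot> ?F) p = op_app ?E (op_app ?T (op_app ?F p))"
      using T_p(1) by (simp add: E(1) F(1))
    \<comment> \<open>The left factor subtracts \<open>B\<close> times the inverse of
      \<open>D\<close>, applied to \<open>D b\<close>, which is \<open>B b\<close>; what remains of
      \<open>A\<close> and \<open>B\<close> is \<open>A a - B (Q a) = S a\<close>.\<close>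
    also have "\<dots> = (op_app S a + op_app X c, op_app D b, op_app Y a + op_app Z c)"
      unfolding T_p(2) E(2) RD[OF b] B_b by (simp add: S_Q a)
    also have "\<dots> = op_app ?S p"
      using a b c by (simp add: p op_app_block3 dom_S)
    finally show "op_app ?S p = op_app (?E \<odot> ?T \<odot> ?F) p" ..
  qed
qed

section \<open>Equivalence of the extended Schur complement with the full matrix\<close>

text \<open>The conclusion has two layers because the assumptions do not bound \<open>B\<close>
  times the inverse of \<open>D\<close>: for \<open>D = id_op\<close> on an infinite-dimensional
  space and an everywhere defined unbounded \<open>B\<close>, the factor \<open>E\<close> is
  unbounded. The factorisation, the domain identity and the bijectivity of \<open>E\<close> hold in
  any case; equivalence, which asks for \<open>E\<close> in \<open>bounded_ops\<close>, is stated
  under boundedness of that product.\<close>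

theorem theorem3p4:
  fixes \<Omega>\<^sub>D \<Omega>' \<Omega> :: "complex set"
    and D :: "complex \<Rightarrow> ('hc::complex_banach, 'hc) lin_op"
    and A :: "complex \<Rightarrow> ('h::complex_banach, 'h1::complex_banach) lin_op"
    and B :: "complex \<Rightarrow> ('hc, 'h1) lin_op"
    and C :: "complex \<Rightarrow> ('h, 'hc) lin_op"
    and X :: "complex \<Rightarrow> ('ht::complex_banach, 'h1) lin_op"
    and Y :: "complex \<Rightarrow> ('h, 'ht1::complex_banach) lin_op"
    and Z :: "complex \<Rightarrow> ('ht, 'ht1) lin_op"
    and S :: "complex \<Rightarrow> ('h, 'h1) lin_op"
    and SS :: "complex \<Rightarrow> ('h \<times> 'ht, 'h1 \<times> 'ht1) lin_op"
    and TT SSext :: "complex \<Rightarrow> ('h \<times> 'hc \<times> 'ht, 'h1 \<times> 'hc \<times> 'ht1) lin_op"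
    and E :: "complex \<Rightarrow> ('h1 \<times> 'hc \<times> 'ht1, 'h1 \<times> 'hc \<times> 'ht1) lin_op"
    and F :: "complex \<Rightarrow> ('h \<times> 'hc \<times> 'ht, 'h \<times> 'hc \<times> 'ht) lin_op"
  assumes \<Omega>'_subset: "\<Omega>' \<subseteq> \<Omega>\<^sub>D \<inter> {z. 0 \<in> resolvent_set (D z)}"
    and \<Omega>'_nonempty: "\<Omega>' \<noteq> {}"
    and dom_D_subset: "\<And>z. z \<in> \<Omega>' \<Longrightarrow> op_dom (D z) \<subseteq> op_dom (B z)"
    and C_dense: "\<And>z. z \<in> \<Omega>' \<Longrightarrow> densely_defined (C z)"
    and DC_bounded: "\<And>z. z \<in> \<Omega>' \<Longrightarrow> op_bounded (op_inv (D z) \<odot> C z)"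
    and dom_S: "\<And>z. z \<in> \<Omega>' \<Longrightarrow> op_dom (S z) = op_dom (A z) \<inter> op_dom (C z)"
    and S_eq: "\<And>z x. z \<in> \<Omega>' \<Longrightarrow> x \<in> op_dom (A z) \<inter> op_dom (C z) \<Longrightarrow>
      op_app (S z) x = op_app (A z) x - op_app (B z) (op_app (op_inv (D z)) (op_app (C z) x))"
    and \<Omega>_subset: "\<Omega> \<subseteq> \<Omega>'"
    and SS_eq: "\<And>z. z \<in> \<Omega> \<Longrightarrow>
      SS z = block2 (S z) (X z)
                    (Y z) (Z z)"
    and TT_eq: "\<And>z. z \<in> \<Omega> \<Longrightarrow>
      TT z = block3 (A z) (B z) (X z)
                    (C z) (D z) 0
                    (Y z) 0     (Z z)"
    and SSext_eq: "\<And>z. z \<in> \<Omega> \<Longrightarrow>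
      SSext z = block3 (S z) 0     (X z)
                       0     (D z) 0
                       (Y z) 0     (Z z)"
    and E_eq: "\<And>z. z \<in> \<Omega> \<Longrightarrow>
      E z = block3 id_op (- (B z \<odot> op_inv (D z))) 0
                   0     id_op                     0
                   0     0                         id_op"
    and F_eq: "\<And>z. z \<in> \<Omega> \<Longrightarrow>
      F z = block3 id_op                              0     0
                   (- op_closure (op_inv (D z) \<odot> C z)) id_op 0
                   0                                  0     id_op"
  shows "(\<forall>z\<in>\<Omega>.
            op_invertible (D z) \<and> SSext z = middle_sum (SS z) (D z) \<and>
            op_dom (E z) = UNIV \<and> op_inj (E z) \<and> op_range (E z) = UNIV \<and>
            F z \<in> bounded_ops \<and> op_invertible (F z) \<and>
            SSext z = E z \<odot> TT z \<odot> F z \<and>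
            op_dom (SSext z) = op_app (op_inv (F z)) ` op_dom (TT z)) \<and>
         ((\<forall>z\<in>\<Omega>. op_bounded (B z \<odot> op_inv (D z))) \<longrightarrow>
            after_extension_equivalent_on \<Omega> SS D TT \<and> equivalent_via \<Omega> SSext TT E F)"
proof -
  let ?R = "\<lambda>z. B z \<odot> op_inv (D z)" and ?Q = "\<lambda>z. op_closure (op_inv (D z) \<odot> C z)"
  have D: "op_invertible (D z)" if "z \<in> \<Omega>" for z
    using that \<Omega>'_subset \<Omega>_subset by (auto simp: zero_in_resolvent_set_iff)
  have R_dom: "op_dom (?R z) = UNIV" if "z \<in> \<Omega>" for z
    using dom_D_subset[of z] \<Omega>_subset op_invertibleD[OF D[OF that]] that by auto
  \<comment> \<open>The inverse of \<open>D\<close> is everywhere defined, so the product keeps the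
    domain of \<open>C\<close> and with it the density.\<close>
  have DC_dom: "op_dom (op_inv (D z) \<odot> C z) = op_dom (C z)" if "z \<in> \<Omega>" for z
    using op_invertibleD(3)[OF D[OF that]] by simp
  have DC_dense: "densely_defined (op_inv (D z) \<odot> C z)" if "z \<in> \<Omega>" for z
    using C_dense[of z] \<Omega>_subset that unfolding densely_defined_def DC_dom[OF that] by blast
  have DC: "op_bounded (op_inv (D z) \<odot> C z)" if "z \<in> \<Omega>" for z
    using DC_bounded[of z] \<Omega>_subset that by blast
  have Q: "?Q z \<in> bounded_ops" if "z \<in> \<Omega>" for z
    using op_closure_in_bounded_ops[OF DC DC_dense] that by blast
  have Q_eq: "op_app (?Q z) x = op_app (op_inv (D z)) (op_app (C z) x)"
    if "z \<in> \<Omega>" "x \<in> op_dom (C z)" for z x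
    using op_app_op_closure[OF DC DC_dense, of z x] op_invertibleD(3)[OF D] that by simp
  have ext: "SSext z = middle_sum (SS z) (D z)" if "z \<in> \<Omega>" for z
    using that by (simp add: SSext_eq SS_eq middle_sum_block2)
  have E: "op_dom (E z) = UNIV" "op_inj (E z)" "op_range (E z) = UNIV" if "z \<in> \<Omega>" for z
    using R_dom[OF that] unfolding E_eq[OF that]
    by (intro upper_unipotent_total op_inj_upper_unipotent op_range_upper_unipotent; simp)+
  have F: "F z \<in> bounded_ops" "op_invertible (F z)" if "z \<in> \<Omega>" for z
    unfolding F_eq[OF that] using Q[OF that]
    by (simp_all add: unipotent_bounded_ops op_invertible_lower_unipotent uminus_in_bounded_ops)
  have ETF: "SSext z = E z \<odot> TT z \<odot> F z" if "z \<in> \<Omega>" for z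
  proof -
    have z: "z \<in> \<Omega>'"
      using that \<Omega>_subset by blast
    show ?thesis
      unfolding SSext_eq[OF that] E_eq[OF that] TT_eq[OF that] F_eq[OF that]
      using D[OF that] dom_D_subset[OF z] Q[OF that] Q_eq[OF that] dom_S[OF z] S_eq[OF z]
      by (intro schur_factorisation) (simp_all add: bounded_ops_def)
  qed
  have dom: "op_dom (SSext z) = op_app (op_inv (F z)) ` op_dom (TT z)" if "z \<in> \<Omega>" for z
    unfolding ETF[OF that] using E(1)[OF that] F[OF that]
    by (intro op_dom_comp_image_inv) (simp_all add: bounded_ops_def)
  have equiv: "equivalent_via \<Omega> SSext TT E F" if bdd: "\<forall>z\<in>\<Omega>. op_bounded (?R z)"
  proof -
    \<comment> \<open>Together with its everywhere defined domain, boundedness of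
      \<open>?R z\<close> makes both \<open>E z\<close> and its inverse bounded, the inverse being
      the same matrix with the opposite sign at the off-diagonal entry.\<close>
    have "- ?R z \<in> bounded_ops" if "z \<in> \<Omega>" for z
      using bdd R_dom[OF that] that by (intro uminus_in_bounded_ops) (simp add: bounded_ops_def)
    then have "E z \<in> bounded_ops" "op_invertible (E z)" if "z \<in> \<Omega>" for z
      using that by (simp_all add: E_eq unipotent_bounded_ops op_invertible_upper_unipotent)
    then show ?thesis
      unfolding equivalent_via_def using F ETF dom by blast
  qed
  moreover have "after_extension_equivalent_on \<Omega> SS D TT" if "equivalent_via \<Omega> SSext TT E F"
  proof -
    \<comment> \<open>The two operator functions are known to agree only on \<open>\<Omega>\<close>,
      so the exchange is made under the bounded quantifier and not by an equation between
      functions.\<close>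
    have "equivalent_via \<Omega> SSext TT E F \<longleftrightarrow>
        equivalent_via \<Omega> (\<lambda>z. middle_sum (SS z) (D z)) TT E F"
      unfolding equivalent_via_def by (rule ball_cong) (simp_all only: ext)
    then have "equivalent_on \<Omega> (\<lambda>z. middle_sum (SS z) (D z)) TT"
      using that unfolding equivalent_on_def by (intro exI) (rule iffD1)
    then show ?thesis
      by (simp add: after_extension_equivalent_on_def D)
  qed
  ultimately show ?thesis
    using D ext E F ETF dom by (intro conjI ballI impI) simp_all
qed

end
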